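(* Let $\tilde s_i$ ($1\le i\le N_0$), $\tilde t_j$ ($1\le j\le N_1$) be the Intermediate Long Wave (ILW) limits of solutions of the $\mathcal E_2$ Bethe ansatz equations, as described in the context; they depend on the parameter $\tau$. In the conformal limit one further sends $\tau\to0$. Let $\lim_{\tau\to0}\tilde s_i=\bar s_i$ and $\lim_{\tau\to0}\tilde t_j=\bar t_j$ be the corresponding limits. Then the limits $\bar s_i,\bar t_j$ satisfy the system of equations $$\frac{r-\hat\pi-2}{\bar s_i}+\frac1{\bar s_i-v}-\sum_{k=1,\,k\ne i}^{N_0}\frac2{\bar s_i-\bar s_k}+\sum_{k=1}^{N_1}\frac2{\bar s_i-\bar t_k}=0,\qquad i=1,\dots,N_0,$$ $$\frac{\hat\pi-1}{\bar t_j}-\sum_{k=1,\,k\ne j}^{N_1}\frac2{\bar t_j-\bar t_k}+\sum_{k=1}^{N_0}\frac2{\bar t_j-\bar s_k}=0,\qquad j=1,\dots,N_1.$$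
   Context: Let $s_i$ ($1\le i\le N_0$), $t_j$ ($1\le j\le N_1$) be solutions of the Bethe ansatz equations for the quantum toroidal $\mathfrak{gl}_2$ algebra $\mathcal E_2(q_1^\vee,q_2^\vee,q_3^\vee)$, $q_1^\vee q_2^\vee q_3^\vee=1$, acting on a single Fock module $\mathcal F_0(v)$: $$p_0^\vee\,\frac{s_i-v}{s_i-(q_2^\vee)^{-1}v}\prod_{j=1}^{N_0}\frac{q_2^\vee s_i-s_j}{(q_2^\vee)^{-1}s_i-s_j}\prod_{k=1}^{N_1}\frac{(q_1^\vee s_i-t_k)(q_3^\vee s_i-t_k)}{((q_1^\vee)^{-1}s_i-t_k)((q_3^\vee)^{-1}s_i-t_k)}=-1\qquad(1\le i\le N_0),$$ $$p_1^\vee\prod_{j=1}^{N_1}\frac{q_2^\vee t_i-t_j}{(q_2^\vee)^{-1}t_i-t_j}\prod_{k=1}^{N_0}\frac{(q_1^\vee t_i-s_k)(q_3^\vee t_i-s_k)}{((q_1^\vee)^{-1}t_i-s_k)((q_3^\vee)^{-1}t_i-s_k)}=-1\qquad(1\le i\le N_1).$$ The ILW limit is $\epsilon\to0$ with $$q_1^\vee=e^{-\tau}(1+\epsilon+o(\epsilon)),\quad q_2^\vee=1-\epsilon+o(\epsilon),\quad q_3^\vee=e^\tau,\quad p^\vee=p_0^\vee p_1^\vee=1+r\epsilon+o(\epsilon),\quad p_1^\vee=1-\frac{\hat\pi}{2}\epsilon+o(\epsilon),$$ and $v,\tau,r,\hat\pi$ fixed. The ILW limits of the solutions are $\tilde s_i=\lim_{\epsilon\to0}s_i$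 and $\tilde t_j=\lim_{\epsilon\to0}t_j$.
   Formalization: The expansion of p_1^∨ is taken as 1+π̂ε+o(ε) instead of 1−(π̂/2)ε+o(ε), with which the stated coefficients are wrong for π̂≠0; the limits are assumed nonzero, pairwise distinct and with s̄_i≠v, so that all denominators make sense. *)

theory Defs
  imports Complex_Main "HOL-Library.Landau_Symbols"
begin

text \<open>
  Since \<open>x / 0 = 0\<close>, a vanishing denominator makes a left-hand side equal to \<open>0 \<noteq> -1\<close>. Hence the
  equations below entail that all denominators occurring in them are nonzero.
  As usual, the products over \<open>j\<close> include the diagonal factor \<open>j = i\<close>.
\<close>

definition bethe_solution ::
  "nat \<Rightarrow> nat \<Rightarrow> complex \<Rightarrow> complex \<Rightarrow> complex \<Rightarrow> complex \<Rightarrow> complex \<Rightarrow> complex \<Rightarrow>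
   (nat \<Rightarrow> complex) \<Rightarrow> (nat \<Rightarrow> complex) \<Rightarrow> bool" where
  "bethe_solution N0 N1 v q1 q2 q3 p0 p1 s t \<longleftrightarrow>
    (\<forall>i\<in>{1..N0}.
      p0 * ((s i - v) / (s i - inverse q2 * v))
      * (\<Prod>j=1..N0. (q2 * s i - s j) / (inverse q2 * s i - s j))
      * (\<Prod>k=1..N1. ((q1 * s i - t k) * (q3 * s i - t k)) /
                    ((inverse q1 * s i - t k) * (inverse q3 * s i - t k))) = -1) \<and>
    (\<forall>i\<in>{1..N1}.
      p1
      * (\<Prod>j=1..N1. (q2 * t i - t j) / (inverse q2 * t i - t j))
      * (\<Prod>k=1..N0. ((q1 * t i - s k) * (q3 * t i - s k)) /
                    ((inverse q1 * t i - s k) * (inverse q3 * t i - s k))) = -1)"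

text \<open>
  The ILW regime for fixed \<open>\<tau>\<close>: the parameters are functions of \<open>\<epsilon>\<close>, and \<open>\<epsilon> \<rightarrow> 0\<close> along the filter \<open>F\<close>.
  The parameter \<open>\<pi>\<close> (the paper's \<open>\<pi>\<close> with a hat) is normalised by \<open>p1 = 1 + \<pi> \<epsilon> + o(\<epsilon>)\<close>. This is
  the normalisation under which the coefficients \<open>r - \<pi> - 2\<close> and \<open>\<pi> - 1\<close> of the conformal limit
  are correct. The expansion \<open>p1 = 1 - (\<pi>/2) \<epsilon> + o(\<epsilon>)\<close> describes the same family of
  parameters with \<open>-\<pi>/2\<close> in place of \<open>\<pi>\<close>, and would give the coefficients
  \<open>r + \<pi>/2 - 2\<close> and \<open>-\<pi>/2 - 1\<close>.
\<close>

definition ilw_regime ::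
  "complex filter \<Rightarrow> complex \<Rightarrow> complex \<Rightarrow> complex \<Rightarrow>
   (complex \<Rightarrow> complex) \<Rightarrow> (complex \<Rightarrow> complex) \<Rightarrow> (complex \<Rightarrow> complex) \<Rightarrow>
   (complex \<Rightarrow> complex) \<Rightarrow> (complex \<Rightarrow> complex) \<Rightarrow> bool" where
  "ilw_regime F \<tau> r \<pi> q1 q2 q3 p0 p1 \<longleftrightarrow>
    (\<forall>\<^sub>F \<epsilon> in F. q1 \<epsilon> * q2 \<epsilon> * q3 \<epsilon> = 1) \<and>
    (\<lambda>\<epsilon>. q1 \<epsilon> - exp (- \<tau>) * (1 + \<epsilon>)) \<in> o[F](\<lambda>\<epsilon>. \<epsilon>) \<and>
    (\<lambda>\<epsilon>. q2 \<epsilon> - (1 - \<epsilon>)) \<in> o[F](\<lambda>\<epsilon>. \<epsilon>) \<and>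
    (\<forall>\<^sub>F \<epsilon> in F. q3 \<epsilon> = exp \<tau>) \<and>
    (\<lambda>\<epsilon>. p0 \<epsilon> * p1 \<epsilon> - (1 + r * \<epsilon>)) \<in> o[F](\<lambda>\<epsilon>. \<epsilon>) \<and>
    (\<lambda>\<epsilon>. p1 \<epsilon> - (1 + \<pi> * \<epsilon>)) \<in> o[F](\<lambda>\<epsilon>. \<epsilon>)"

end

theory Submission
  imports Defs
begin

text \<open>
  As \<open>\<epsilon> \<rightarrow> 0\<close> the Bethe equations degenerate to \<open>-1 = -1\<close>, so the information about the limits sits
  in the coefficient of \<open>\<epsilon>\<close>. The diagonal factor \<open>j = i\<close> equals \<open>-q\<^sub>2\<close> exactly and absorbs the sign
  on the right-hand side. Apart from \<open>p\<^sub>0\<close> and \<open>p\<^sub>1\<close>, every other factor is a quotient \<open>A / B\<close> in which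
  numerator and denominator have the same nonzero limit and differ by \<open>O(\<epsilon>)\<close>. Up to that sign all
  factors have the form \<open>1 + c \<epsilon> + o(\<epsilon>)\<close>, for which the \<open>\<epsilon>\<close>-coefficient is additive under
  multiplication; hence the \<open>\<epsilon>\<close>-coefficient of their product is a constant plus a sum of fractions,
  and it must vanish. With \<open>a = e\<^sup>\<tau>\<close>, the two families of Bethe roots interact through
  \<open>a\<^sup>-\<^sup>1 x / (a\<^sup>-\<^sup>1 x - y) + a x / (a x - y)\<close>, the pairing being \<open>q\<^sub>1\<close> against \<open>1 / q\<^sub>3\<close> and
  \<open>q\<^sub>3\<close> against \<open>1 / q\<^sub>1\<close>; as \<open>\<tau> \<rightarrow> 0\<close> this becomes \<open>2 x / (x - y)\<close>.

  The equations for the \<open>s\<^sub>i\<close> and for the \<open>t\<^sub>j\<close> have the same shape and differ only in a prefactor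
  whose expansion is \<open>1 + c \<epsilon> + o(\<epsilon>)\<close>, so both follow from \<open>bethe_first_order\<close> (the limit
  \<open>\<epsilon> \<rightarrow> 0\<close> at fixed \<open>\<tau>\<close>) and \<open>bethe_conformal_limit\<close> (the subsequent limit \<open>\<tau> \<rightarrow> 0\<close>).
  The nondegeneracy of the conformal limits enters as an open condition: it makes the ILW limits
  nondegenerate for all \<open>\<tau>\<close> close to \<open>0\<close>, which is where the expansion in \<open>\<epsilon>\<close> is carried out.
\<close>

section \<open>First-order expansions along a filter\<close>

text \<open>
  The expansion \<open>f \<epsilon> = b + c \<epsilon> + o(\<epsilon>)\<close>, phrased by a difference quotient so that coefficients can be
  computed by limit rules. Here \<open>b\<close> is the limit of \<open>f\<close>, which can differ from \<open>f 0\<close>: the Bethe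
  factors are only considered along a filter that excludes \<open>\<epsilon> = 0\<close>.
\<close>

definition expands :: "'a::real_normed_field filter \<Rightarrow> ('a \<Rightarrow> 'a) \<Rightarrow> 'a \<Rightarrow> 'a \<Rightarrow> bool" where
  "expands F f b c \<longleftrightarrow> ((\<lambda>\<epsilon>. (f \<epsilon> - b) / \<epsilon>) \<longlongrightarrow> c) F"

lemma eventually_nonzero: "F \<le> at 0 \<Longrightarrow> \<forall>\<^sub>F \<epsilon> in F. \<epsilon> \<noteq> (0::'a::real_normed_field)"
  by (erule filter_leD) (simp add: eventually_at_filter)

lemma expands_cong:
  assumes "expands F f b c" "\<forall>\<^sub>F \<epsilon> in F. f \<epsilon> = g \<epsilon>"
  shows "expands F g b c"
  using assms(1) unfolding expands_def
  by (rule Lim_transform_eventually) (use assms(2) in eventually_elim, simp)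

lemma expands_smallo:
  assumes "F \<le> at 0" "(\<lambda>\<epsilon>. f \<epsilon> - (b + c * \<epsilon>)) \<in> o[F](\<lambda>\<epsilon>. \<epsilon>)"
  shows "expands F f b c"
proof -
  have "((\<lambda>\<epsilon>. (f \<epsilon> - (b + c * \<epsilon>)) / \<epsilon> + c) \<longlongrightarrow> 0 + c) F"
    by (intro tendsto_intros smalloD_tendsto assms)
  moreover have "\<forall>\<^sub>F \<epsilon> in F. (f \<epsilon> - (b + c * \<epsilon>)) / \<epsilon> + c = (f \<epsilon> - b) / \<epsilon>"
    using eventually_nonzero[OF assms(1)] by eventually_elim (simp add: field_simps)
  ultimately show ?thesis
    unfolding expands_def by (simp add: Lim_transform_eventually)
qed

lemma expands_const: "expands F (\<lambda>\<epsilon>. b) b 0"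
  by (simp add: expands_def)

lemma expands_diff:
  assumes "expands F f b c" "expands F g b' c'"
  shows "expands F (\<lambda>\<epsilon>. f \<epsilon> - g \<epsilon>) (b - b') (c - c')"
proof -
  have "(f \<epsilon> - b) / \<epsilon> - (g \<epsilon> - b') / \<epsilon> = (f \<epsilon> - g \<epsilon> - (b - b')) / \<epsilon>" for \<epsilon>
    by (simp add: algebra_simps flip: diff_divide_distrib)
  then show ?thesis
    using tendsto_diff[OF assms[unfolded expands_def]] by (simp add: expands_def)
qed

lemma expands_imp_tendsto:
  assumes "F \<le> at 0" "expands F f b c"
  shows "(f \<longlongrightarrow> b) F"
proof -
  have "((\<lambda>\<epsilon>. (f \<epsilon> - b) / \<epsilon> * \<epsilon> + b) \<longlongrightarrow> c * 0 + b) F"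
    by (intro tendsto_intros assms(2)[unfolded expands_def] tendsto_mono[OF assms(1)])
  moreover have "\<forall>\<^sub>F \<epsilon> in F. (f \<epsilon> - b) / \<epsilon> * \<epsilon> + b = f \<epsilon>"
    using eventually_nonzero[OF assms(1)] by eventually_elim simp
  ultimately show ?thesis by (simp add: Lim_transform_eventually)
qed

lemma expands_mult:
  assumes "F \<le> at 0" "expands F f b c" "expands F g b' c'"
  shows "expands F (\<lambda>\<epsilon>. f \<epsilon> * g \<epsilon>) (b * b') (c * b' + b * c')"
proof -
  have "((\<lambda>\<epsilon>. (f \<epsilon> - b) / \<epsilon> * g \<epsilon> + b * ((g \<epsilon> - b') / \<epsilon>)) \<longlongrightarrow> c * b' + b * c') F"
    by (intro tendsto_intros assms(2,3)[unfolded expands_def] expands_imp_tendsto[OF assms(1,3)])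
  then show ?thesis
    unfolding expands_def by (simp add: algebra_simps diff_divide_distrib)
qed

lemma expands_one_prod:
  assumes "F \<le> at 0" "finite A" "\<And>k. k \<in> A \<Longrightarrow> expands F (f k) 1 (c k)"
  shows "expands F (\<lambda>\<epsilon>. \<Prod>k\<in>A. f k \<epsilon>) 1 (\<Sum>k\<in>A. c k)"
  using assms(2,3)
proof (induction A rule: finite_induct)
  case empty
  show ?case by (simp add: expands_const)
next
  case (insert k A)
  then show ?case
    using expands_mult[OF assms(1), of "f k" 1 "c k" "\<lambda>\<epsilon>. \<Prod>k\<in>A. f k \<epsilon>" 1 "\<Sum>k\<in>A. c k"] by simp
qed

lemma expands_inverse:
  assumes "F \<le> at 0" "expands F f b c" "b \<noteq> 0"
  shows "expands F (\<lambda>\<epsilon>. inverse (f \<epsilon>)) (inverse b) (- c / b\<^sup>2)"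
proof -
  note lim = expands_imp_tendsto[OF assms(1,2)]
  have "((\<lambda>\<epsilon>. - ((f \<epsilon> - b) / \<epsilon>) / (f \<epsilon> * b)) \<longlongrightarrow> - c / (b * b)) F"
    by (intro tendsto_intros assms(2)[unfolded expands_def] lim) (use assms(3) in simp)
  moreover have "\<forall>\<^sub>F \<epsilon> in F. - ((f \<epsilon> - b) / \<epsilon>) / (f \<epsilon> * b) = (inverse (f \<epsilon>) - inverse b) / \<epsilon>"
    using tendsto_imp_eventually_ne[OF lim assms(3)] eventually_nonzero[OF assms(1)]
    by eventually_elim (use assms(3) in \<open>simp add: field_simps\<close>)
  ultimately show ?thesis
    by (simp add: expands_def power2_eq_square Lim_transform_eventually)
qed

text \<open>
  The shape of every off-diagonal factor in the Bethe equations. Convergence of the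
  Bethe roots \<open>x\<close> and \<open>y\<close>, at whatever rate, suffices: the quotient minus one is \<open>(\<alpha> - \<beta>) x\<close> over
  the denominator, and \<open>\<alpha> - \<beta>\<close> is already of order \<open>\<epsilon>\<close> because \<open>\<alpha>\<close> and \<open>\<beta>\<close> have the same limit \<open>b\<close>.
\<close>

lemma expands_ratio:
  assumes "F \<le> at 0" "expands F \<alpha> b c" "expands F \<beta> b d"
    and "(x \<longlongrightarrow> X) F" "(y \<longlongrightarrow> Y) F" "b * X \<noteq> Y"
  shows "expands F (\<lambda>\<epsilon>. (\<alpha> \<epsilon> * x \<epsilon> - y \<epsilon>) / (\<beta> \<epsilon> * x \<epsilon> - y \<epsilon>)) 1 ((c - d) * X / (b * X - Y))"
proof -
  have den: "((\<lambda>\<epsilon>. \<beta> \<epsilon> * x \<epsilon> - y \<epsilon>) \<longlongrightarrow> b * X - Y) F"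
    by (intro tendsto_intros assms expands_imp_tendsto[OF assms(1,3)])
  have "((\<lambda>\<epsilon>. (\<alpha> \<epsilon> - \<beta> \<epsilon> - (b - b)) / \<epsilon> * x \<epsilon> / (\<beta> \<epsilon> * x \<epsilon> - y \<epsilon>))
      \<longlongrightarrow> (c - d) * X / (b * X - Y)) F"
    by (intro tendsto_intros den assms(4) expands_diff[OF assms(2,3), unfolded expands_def])
      (use assms(6) in simp)
  moreover have "\<forall>\<^sub>F \<epsilon> in F. \<beta> \<epsilon> * x \<epsilon> - y \<epsilon> \<noteq> 0"
    using den by (rule tendsto_imp_eventually_ne) (use assms(6) in simp)
  then have "\<forall>\<^sub>F \<epsilon> in F. (\<alpha> \<epsilon> - \<beta> \<epsilon> - (b - b)) / \<epsilon> * x \<epsilon> / (\<beta> \<epsilon> * x \<epsilon> - y \<epsilon>)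
      = ((\<alpha> \<epsilon> * x \<epsilon> - y \<epsilon>) / (\<beta> \<epsilon> * x \<epsilon> - y \<epsilon>) - 1) / \<epsilon>"
    using eventually_nonzero[OF assms(1)]
    by eventually_elim (simp add: divide_simps, simp add: algebra_simps)
  ultimately show ?thesis
    unfolding expands_def by (rule Lim_transform_eventually)
qed

section \<open>The limit of a Bethe equation as \<open>\<epsilon> \<rightarrow> 0\<close>\<close>

text \<open>
  One Bethe equation at fixed \<open>\<tau>\<close>, where \<open>a\<close> stands for \<open>e\<^sup>\<tau>\<close>: \<open>x\<close> is the family to which the
  equation belongs and \<open>y\<close> the other one. The term \<open>-1\<close> next to \<open>c\<close> comes from the diagonal factor
  \<open>-q\<^sub>2\<close>.
\<close>

lemma bethe_first_order:
  fixes x y :: "'a::real_normed_field \<Rightarrow> nat \<Rightarrow> 'a"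
  assumes F: "F \<le> at 0" "F \<noteq> bot"
    and i: "i \<in> {1..M}" and a: "a \<noteq> 0"
    and P: "expands F P 1 c"
    and q1: "expands F q1 (inverse a) (inverse a)"
    and q2: "expands F q2 1 (- 1)"
    and q3: "\<forall>\<^sub>F \<epsilon> in F. q3 \<epsilon> = a"
    and x: "\<And>k. k \<in> {1..M} \<Longrightarrow> ((\<lambda>\<epsilon>. x \<epsilon> k) \<longlongrightarrow> X k) F"
    and y: "\<And>k. k \<in> {1..N} \<Longrightarrow> ((\<lambda>\<epsilon>. y \<epsilon> k) \<longlongrightarrow> Y k) F"
    and X0: "X i \<noteq> 0"
    and XX: "\<And>k. k \<in> {1..M} - {i} \<Longrightarrow> X i \<noteq> X k"
    and XY: "\<And>k. k \<in> {1..N} \<Longrightarrow> inverse a * X i \<noteq> Y k \<and> a * X i \<noteq> Y k"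
    and eq: "\<forall>\<^sub>F \<epsilon> in F. P \<epsilon>
      * (\<Prod>j=1..M. (q2 \<epsilon> * x \<epsilon> i - x \<epsilon> j) / (inverse (q2 \<epsilon>) * x \<epsilon> i - x \<epsilon> j))
      * (\<Prod>k=1..N. ((q1 \<epsilon> * x \<epsilon> i - y \<epsilon> k) * (q3 \<epsilon> * x \<epsilon> i - y \<epsilon> k)) /
          ((inverse (q1 \<epsilon>) * x \<epsilon> i - y \<epsilon> k) * (inverse (q3 \<epsilon>) * x \<epsilon> i - y \<epsilon> k))) = - 1"
  shows "c - 1 - (\<Sum>k\<in>{1..M} - {i}. 2 * X i / (X i - X k))
    + (\<Sum>k=1..N. inverse a * X i / (inverse a * X i - Y k) + a * X i / (a * X i - Y k)) = 0"
proof -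
  define f where "f k \<epsilon> = (q2 \<epsilon> * x \<epsilon> i - x \<epsilon> k) / (inverse (q2 \<epsilon>) * x \<epsilon> i - x \<epsilon> k)" for k \<epsilon>
  define g where "g k \<epsilon> = ((q1 \<epsilon> * x \<epsilon> i - y \<epsilon> k) / (inverse (q3 \<epsilon>) * x \<epsilon> i - y \<epsilon> k))
      * ((q3 \<epsilon> * x \<epsilon> i - y \<epsilon> k) / (inverse (q1 \<epsilon>) * x \<epsilon> i - y \<epsilon> k))" for k \<epsilon>
  define S where "S = (\<Sum>k\<in>{1..M} - {i}. - 2 * X i / (X i - X k))"
  define T where
    "T = (\<Sum>k=1..N. inverse a * X i / (inverse a * X i - Y k) + a * X i / (a * X i - Y k))"

  have q2_inv: "expands F (\<lambda>\<epsilon>. inverse (q2 \<epsilon>)) 1 1"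
    using expands_inverse[OF F(1) q2] by simp
  have q1_inv: "expands F (\<lambda>\<epsilon>. inverse (q1 \<epsilon>)) a (- a)"
    using expands_inverse[OF F(1) q1] a by (simp add: power2_eq_square flip: inverse_eq_divide)
  have q3': "expands F q3 a 0"
    by (rule expands_cong[OF expands_const]) (use q3 in \<open>simp add: eq_commute\<close>)
  have q3_inv: "expands F (\<lambda>\<epsilon>. inverse (q3 \<epsilon>)) (inverse a) 0"
    using expands_inverse[OF F(1) q3' a] by simp

  have f: "expands F (f k) 1 (- 2 * X i / (X i - X k))" if k: "k \<in> {1..M} - {i}" for k
    using expands_ratio[OF F(1) q2 q2_inv x[OF i] x[of k]] XX[OF k] k by (simp add: f_def[abs_def])
  have g: "expands F (g k) 1 (inverse a * X i / (inverse a * X i - Y k) + a * X i / (a * X i - Y k))"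
    if k: "k \<in> {1..N}" for k
    using expands_mult[OF F(1) expands_ratio[OF F(1) q1 q3_inv x[OF i] y[OF k]]
        expands_ratio[OF F(1) q3' q1_inv x[OF i] y[OF k]]] XY[OF k]
    by (simp add: g_def[abs_def])
  have "expands F (\<lambda>\<epsilon>. P \<epsilon> * q2 \<epsilon> * (\<Prod>k\<in>{1..M} - {i}. f k \<epsilon>) * (\<Prod>k=1..N. g k \<epsilon>)) 1
      (c + - 1 + S + T)"
    using expands_mult[OF F(1) expands_mult[OF F(1) expands_mult[OF F(1) P q2]
        expands_one_prod[OF F(1), of "{1..M} - {i}" f]] expands_one_prod[OF F(1), of "{1..N}" g]] f g
    by (simp add: S_def T_def)
  moreover have "\<forall>\<^sub>F \<epsilon> in F. P \<epsilon> * q2 \<epsilon> * (\<Prod>k\<in>{1..M} - {i}. f k \<epsilon>) * (\<Prod>k=1..N. g k \<epsilon>) = 1"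
  proof -
    \<comment> \<open>The diagonal factor is \<open>(q\<^sub>2 - 1) / (1 / q\<^sub>2 - 1) = - q\<^sub>2\<close>; this needs \<open>q\<^sub>2 \<noteq> 1\<close> for
      \<open>\<epsilon> \<noteq> 0\<close>, which holds because the coefficient of \<open>\<epsilon>\<close> in \<open>q\<^sub>2\<close> is nonzero.\<close>
    have "\<forall>\<^sub>F \<epsilon> in F. (q2 \<epsilon> - 1) / \<epsilon> \<noteq> 0"
      using q2 unfolding expands_def by (rule tendsto_imp_eventually_ne) simp
    moreover have "\<forall>\<^sub>F \<epsilon> in F. q2 \<epsilon> \<noteq> 0"
      using expands_imp_tendsto[OF F(1) q2] by (rule tendsto_imp_eventually_ne) simp
    moreover have "\<forall>\<^sub>F \<epsilon> in F. x \<epsilon> i \<noteq> 0"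
      using x[OF i] X0 by (rule tendsto_imp_eventually_ne)
    ultimately show ?thesis
      using eq
    proof eventually_elim
      case (elim \<epsilon>)
      have "inverse (q2 \<epsilon>) \<noteq> 1"
        using elim(1) by auto
      then have "f i \<epsilon> = (q2 \<epsilon> - 1) / (inverse (q2 \<epsilon>) - 1)"
        using elim(3) by (simp add: f_def divide_simps) (simp add: algebra_simps)
      also have "\<dots> = - q2 \<epsilon>"
        using elim(1,2) by (auto simp: field_simps)
      finally have diag: "f i \<epsilon> = - q2 \<epsilon>" .
      have "(\<Prod>j=1..M. f j \<epsilon>) = f i \<epsilon> * (\<Prod>k\<in>{1..M} - {i}. f k \<epsilon>)"
        using i by (intro prod.remove) auto
      moreover have "P \<epsilon> * (\<Prod>j=1..M. f j \<epsilon>) * (\<Prod>k=1..N. g k \<epsilon>) = - 1"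
        using elim(4) by (simp add: f_def g_def mult.commute)
      ultimately have "- (P \<epsilon> * q2 \<epsilon> * (\<Prod>k\<in>{1..M} - {i}. f k \<epsilon>) * (\<Prod>k=1..N. g k \<epsilon>)) = - 1"
        by (simp add: diag mult.assoc)
      then show ?case
        by (rule neg_equal_iff_equal[THEN iffD1])
    qed
  qed
  ultimately have "expands F (\<lambda>\<epsilon>. 1) 1 (c + - 1 + S + T)"
    by (rule expands_cong)
  then have "c + - 1 + S + T = 0"
    using expands_const[of F 1] F(2) unfolding expands_def by (metis tendsto_unique)
  then show ?thesis
    by (simp add: S_def T_def sum_negf)
qed

section \<open>The conformal limit\<close>

text \<open>
  The Bethe equation in the form obtained by letting \<open>\<epsilon> \<rightarrow> 0\<close> and then \<open>\<tau> \<rightarrow> 0\<close>. The prefactor and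
  its coefficient \<open>c\<close> may depend on \<open>\<tau>\<close>, since the factor with \<open>v\<close> involves the ILW limit of \<open>s\<^sub>i\<close>.
\<close>

lemma bethe_conformal_limit:
  fixes F G :: "complex filter"
    and x y :: "complex \<Rightarrow> complex \<Rightarrow> nat \<Rightarrow> complex"
  assumes F: "F \<le> at 0" "F \<noteq> bot" and G: "G \<le> at 0" "G \<noteq> bot"
    and i: "i \<in> {1..M}"
    and P: "\<forall>\<^sub>F \<tau> in G. expands F (P \<tau>) 1 (c \<tau>)" and c: "(c \<longlongrightarrow> C) G"
    and regime: "\<forall>\<^sub>F \<tau> in G. ilw_regime F \<tau> r p (q1 \<tau>) (q2 \<tau>) (q3 \<tau>) (p0 \<tau>) (p1 \<tau>)"
    and x: "\<forall>\<^sub>F \<tau> in G. \<forall>k\<in>{1..M}. ((\<lambda>\<epsilon>. x \<tau> \<epsilon> k) \<longlongrightarrow> X \<tau> k) F"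
    and y: "\<forall>\<^sub>F \<tau> in G. \<forall>k\<in>{1..N}. ((\<lambda>\<epsilon>. y \<tau> \<epsilon> k) \<longlongrightarrow> Y \<tau> k) F"
    and X': "\<forall>k\<in>{1..M}. ((\<lambda>\<tau>. X \<tau> k) \<longlongrightarrow> X' k) G"
    and Y': "\<forall>k\<in>{1..N}. ((\<lambda>\<tau>. Y \<tau> k) \<longlongrightarrow> Y' k) G"
    and X0: "X' i \<noteq> 0" and inj: "inj_on X' {1..M}"
    and XY: "\<forall>k\<in>{1..N}. X' i \<noteq> Y' k"
    and eq: "\<forall>\<^sub>F \<tau> in G. \<forall>\<^sub>F \<epsilon> in F. P \<tau> \<epsilon>
      * (\<Prod>j=1..M. (q2 \<tau> \<epsilon> * x \<tau> \<epsilon> i - x \<tau> \<epsilon> j) / (inverse (q2 \<tau> \<epsilon>) * x \<tau> \<epsilon> i - x \<tau> \<epsilon> j))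
      * (\<Prod>k=1..N. ((q1 \<tau> \<epsilon> * x \<tau> \<epsilon> i - y \<tau> \<epsilon> k) * (q3 \<tau> \<epsilon> * x \<tau> \<epsilon> i - y \<tau> \<epsilon> k)) /
          ((inverse (q1 \<tau> \<epsilon>) * x \<tau> \<epsilon> i - y \<tau> \<epsilon> k) * (inverse (q3 \<tau> \<epsilon>) * x \<tau> \<epsilon> i - y \<tau> \<epsilon> k))) = - 1"
  shows "(C - 1) / X' i - (\<Sum>k\<in>{1..M} - {i}. 2 / (X' i - X' k)) + (\<Sum>k=1..N. 2 / (X' i - Y' k)) = 0"
proof -
  note X = X'[rule_format] and Y = Y'[rule_format]
  have exp_lim: "((\<lambda>\<tau>. exp \<tau>) \<longlongrightarrow> (1::complex)) G"
    using tendsto_exp[OF tendsto_mono[OF G(1) tendsto_ident_at]] by simp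
  have exp_inv_lim: "((\<lambda>\<tau>. inverse (exp \<tau>)) \<longlongrightarrow> (1::complex)) G"
    using tendsto_inverse[OF exp_lim] by simp
  have XX': "X' i - X' k \<noteq> 0" if "k \<in> {1..M} - {i}" for k
    using inj_onD[OF inj _ i, of k] that by auto
  have nz_X: "\<forall>\<^sub>F \<tau> in G. X \<tau> i \<noteq> 0"
    using X[OF i] X0 by (rule tendsto_imp_eventually_ne)
  have nz_XX: "\<forall>\<^sub>F \<tau> in G. \<forall>k\<in>{1..M} - {i}. X \<tau> i - X \<tau> k \<noteq> 0"
    by (intro eventually_ball_finite ballI tendsto_imp_eventually_ne[OF tendsto_diff[OF X[OF i] X] XX'])
      auto
  have lim1: "((\<lambda>\<tau>. inverse (exp \<tau>) * X \<tau> i) \<longlongrightarrow> X' i) G"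
    using tendsto_mult[OF exp_inv_lim X[OF i]] by simp
  have lim2: "((\<lambda>\<tau>. exp \<tau> * X \<tau> i) \<longlongrightarrow> X' i) G"
    using tendsto_mult[OF exp_lim X[OF i]] by simp
  have nz1: "\<forall>\<^sub>F \<tau> in G. \<forall>k\<in>{1..N}. inverse (exp \<tau>) * X \<tau> i - Y \<tau> k \<noteq> 0"
    by (intro eventually_ball_finite ballI tendsto_imp_eventually_ne[OF tendsto_diff[OF lim1 Y]])
      (use XY in auto)
  have nz2: "\<forall>\<^sub>F \<tau> in G. \<forall>k\<in>{1..N}. exp \<tau> * X \<tau> i - Y \<tau> k \<noteq> 0"
    by (intro eventually_ball_finite ballI tendsto_imp_eventually_ne[OF tendsto_diff[OF lim2 Y]])
      (use XY in auto)
  define E where "E \<tau> = c \<tau> - 1 - (\<Sum>k\<in>{1..M} - {i}. 2 * X \<tau> i / (X \<tau> i - X \<tau> k))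
    + (\<Sum>k=1..N. inverse (exp \<tau>) * X \<tau> i / (inverse (exp \<tau>) * X \<tau> i - Y \<tau> k)
        + exp \<tau> * X \<tau> i / (exp \<tau> * X \<tau> i - Y \<tau> k))" for \<tau>
  have "\<forall>\<^sub>F \<tau> in G. E \<tau> = 0"
    using P regime x y eq nz_X nz_XX nz1 nz2
  proof eventually_elim
    case (elim \<tau>)
    have "expands F (q1 \<tau>) (inverse (exp \<tau>)) (inverse (exp \<tau>))"
      by (rule expands_smallo[OF F(1)])
        (use elim(2) in \<open>simp add: ilw_regime_def exp_minus algebra_simps\<close>)
    moreover have "expands F (q2 \<tau>) 1 (- 1)"
      by (rule expands_smallo[OF F(1)]) (use elim(2) in \<open>simp add: ilw_regime_def\<close>)
    moreover have "\<forall>\<^sub>F \<epsilon> in F. q3 \<tau> \<epsilon> = exp \<tau>"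
      using elim(2) by (simp add: ilw_regime_def)
    ultimately show ?case
      unfolding E_def
      by (intro bethe_first_order[OF F i exp_not_eq_zero elim(1), where x = "x \<tau>" and y = "y \<tau>"])
        (use elim in auto)
  qed
  then have "(E \<longlongrightarrow> 0) G"
    by (rule tendsto_eventually)
  moreover have "(E \<longlongrightarrow> C - 1 - (\<Sum>k\<in>{1..M} - {i}. 2 * X' i / (X' i - X' k))
    + (\<Sum>k=1..N. X' i / (X' i - Y' k) + X' i / (X' i - Y' k))) G"
    unfolding E_def by (intro tendsto_intros c lim1 lim2 X Y i) (use XX' XY in auto)
  ultimately have lim0: "C - 1 - (\<Sum>k\<in>{1..M} - {i}. 2 * X' i / (X' i - X' k))
    + (\<Sum>k=1..N. X' i / (X' i - Y' k) + X' i / (X' i - Y' k)) = 0"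
    using G(2) tendsto_unique by blast
  have "(\<Sum>k\<in>{1..M} - {i}. 2 * X' i / (X' i - X' k)) = X' i * (\<Sum>k\<in>{1..M} - {i}. 2 / (X' i - X' k))"
    by (simp add: sum_distrib_left mult.commute)
  moreover have "(\<Sum>k=1..N. X' i / (X' i - Y' k) + X' i / (X' i - Y' k))
      = X' i * (\<Sum>k=1..N. 2 / (X' i - Y' k))"
    by (simp add: sum_distrib_left mult.commute flip: mult_2)
  ultimately have "C - 1 = X' i * ((\<Sum>k\<in>{1..M} - {i}. 2 / (X' i - X' k)) - (\<Sum>k=1..N. 2 / (X' i - Y' k)))"
    using lim0 by (simp only: right_diff_distrib) (simp add: algebra_simps)
  then show ?thesis
    using X0 by simp
qed

theorem lemma7p3:
  fixes N0 N1 :: nat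
    and v r pihat :: complex
    and F G :: "complex filter"
    and q1 q2 q3 p0 p1 :: "complex \<Rightarrow> complex \<Rightarrow> complex"
    and s t :: "complex \<Rightarrow> complex \<Rightarrow> nat \<Rightarrow> complex"
    and s_ilw t_ilw :: "complex \<Rightarrow> nat \<Rightarrow> complex"
    and s_bar t_bar :: "nat \<Rightarrow> complex"
  assumes eps_to_0: "F \<le> at 0" "F \<noteq> bot"
    and tau_to_0: "G \<le> at 0" "G \<noteq> bot"
    and regime: "\<forall>\<^sub>F \<tau> in G. ilw_regime F \<tau> r pihat (q1 \<tau>) (q2 \<tau>) (q3 \<tau>) (p0 \<tau>) (p1 \<tau>)"
    and bethe: "\<forall>\<^sub>F \<tau> in G. \<forall>\<^sub>F \<epsilon> in F.
      bethe_solution N0 N1 v (q1 \<tau> \<epsilon>) (q2 \<tau> \<epsilon>) (q3 \<tau> \<epsilon>) (p0 \<tau> \<epsilon>) (p1 \<tau> \<epsilon>) (s \<tau> \<epsilon>) (t \<tau> \<epsilon>)"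
    and ilw_limit_s: "\<forall>\<^sub>F \<tau> in G. \<forall>i\<in>{1..N0}. ((\<lambda>\<epsilon>. s \<tau> \<epsilon> i) \<longlongrightarrow> s_ilw \<tau> i) F"
    and ilw_limit_t: "\<forall>\<^sub>F \<tau> in G. \<forall>j\<in>{1..N1}. ((\<lambda>\<epsilon>. t \<tau> \<epsilon> j) \<longlongrightarrow> t_ilw \<tau> j) F"
    and conformal_limit_s: "\<forall>i\<in>{1..N0}. ((\<lambda>\<tau>. s_ilw \<tau> i) \<longlongrightarrow> s_bar i) G"
    and conformal_limit_t: "\<forall>j\<in>{1..N1}. ((\<lambda>\<tau>. t_ilw \<tau> j) \<longlongrightarrow> t_bar j) G"
    and nondeg_s: "\<forall>i\<in>{1..N0}. s_bar i \<noteq> 0 \<and> s_bar i \<noteq> v" "inj_on s_bar {1..N0}"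
    and nondeg_t: "\<forall>j\<in>{1..N1}. t_bar j \<noteq> 0" "inj_on t_bar {1..N1}"
    and nondeg_st: "\<forall>i\<in>{1..N0}. \<forall>j\<in>{1..N1}. s_bar i \<noteq> t_bar j"
  shows "(\<forall>i\<in>{1..N0}.
      (r - pihat - 2) / s_bar i + 1 / (s_bar i - v)
        - (\<Sum>k\<in>{1..N0} - {i}. 2 / (s_bar i - s_bar k))
        + (\<Sum>k=1..N1. 2 / (s_bar i - t_bar k)) = 0) \<and>
    (\<forall>j\<in>{1..N1}.
      (pihat - 1) / t_bar j
        - (\<Sum>k\<in>{1..N1} - {j}. 2 / (t_bar j - t_bar k))
        + (\<Sum>k=1..N0. 2 / (t_bar j - s_bar k)) = 0)"
proof (intro conjI ballI)
  fix i assume i: "i \<in> {1..N0}"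
  define P where
    "P \<tau> \<epsilon> = p0 \<tau> \<epsilon> * ((s \<tau> \<epsilon> i - v) / (s \<tau> \<epsilon> i - inverse (q2 \<tau> \<epsilon>) * v))" for \<tau> \<epsilon>
  have si: "((\<lambda>\<tau>. s_ilw \<tau> i) \<longlongrightarrow> s_bar i) G" "s_bar i \<noteq> 0" "s_bar i \<noteq> v"
    using conformal_limit_s nondeg_s(1) i by auto
  have nz: "\<forall>\<^sub>F \<tau> in G. s_ilw \<tau> i \<noteq> v"
    using si(1,3) by (rule tendsto_imp_eventually_ne)
  have P: "\<forall>\<^sub>F \<tau> in G. expands F (P \<tau>) 1 (r - pihat + v / (s_ilw \<tau> i - v))"
    using regime ilw_limit_s nz
  proof eventually_elim
    case (elim \<tau>)
    have p1: "expands F (p1 \<tau>) 1 pihat" and p01: "expands F (\<lambda>\<epsilon>. p0 \<tau> \<epsilon> * p1 \<tau> \<epsilon>) 1 r"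
      using elim(1) by (auto simp: ilw_regime_def intro: expands_smallo[OF eps_to_0(1)])
    have q2: "expands F (q2 \<tau>) 1 (- 1)"
      by (rule expands_smallo[OF eps_to_0(1)]) (use elim(1) in \<open>simp add: ilw_regime_def\<close>)
    have "\<forall>\<^sub>F \<epsilon> in F. p1 \<tau> \<epsilon> \<noteq> 0"
      using expands_imp_tendsto[OF eps_to_0(1) p1] by (rule tendsto_imp_eventually_ne) simp
    then have "\<forall>\<^sub>F \<epsilon> in F. p0 \<tau> \<epsilon> * p1 \<tau> \<epsilon> * inverse (p1 \<tau> \<epsilon>) = p0 \<tau> \<epsilon>"
      by eventually_elim simp
    moreover have "expands F (\<lambda>\<epsilon>. p0 \<tau> \<epsilon> * p1 \<tau> \<epsilon> * inverse (p1 \<tau> \<epsilon>)) 1 (r - pihat)"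
      using expands_mult[OF eps_to_0(1) p01 expands_inverse[OF eps_to_0(1) p1]] by simp
    ultimately have p0: "expands F (p0 \<tau>) 1 (r - pihat)"
      using expands_cong by blast
    \<comment> \<open>The factor with \<open>v\<close> equals \<open>(v - s\<^sub>i) / (v / q\<^sub>2 - s\<^sub>i)\<close>, so \<open>v\<close> takes the place of \<open>x\<close>.\<close>
    have "expands F (\<lambda>\<epsilon>. (1 * v - s \<tau> \<epsilon> i) / (inverse (q2 \<tau> \<epsilon>) * v - s \<tau> \<epsilon> i)) 1
        ((0 - 1) * v / (1 * v - s_ilw \<tau> i))"
      using expands_inverse[OF eps_to_0(1) q2] elim(2,3) i
      by (intro expands_ratio[OF eps_to_0(1)] expands_const tendsto_const) auto
    moreover have "(1 * v - s \<tau> \<epsilon> i) / (inverse (q2 \<tau> \<epsilon>) * v - s \<tau> \<epsilon> i)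
        = (s \<tau> \<epsilon> i - v) / (s \<tau> \<epsilon> i - inverse (q2 \<tau> \<epsilon>) * v)" for \<epsilon>
      by (metis minus_diff_eq minus_divide_divide mult_1)
    moreover have "(0 - 1) * v / (1 * v - s_ilw \<tau> i) = v / (s_ilw \<tau> i - v)"
      by (metis diff_0 minus_diff_eq minus_divide_divide mult_1 mult_minus1)
    ultimately have
      "expands F (\<lambda>\<epsilon>. (s \<tau> \<epsilon> i - v) / (s \<tau> \<epsilon> i - inverse (q2 \<tau> \<epsilon>) * v)) 1 (v / (s_ilw \<tau> i - v))"
      by simp
    from expands_mult[OF eps_to_0(1) p0 this] show ?case
      by (simp add: P_def[abs_def])
  qed
  have eq: "\<forall>\<^sub>F \<tau> in G. \<forall>\<^sub>F \<epsilon> in F. P \<tau> \<epsilon>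
      * (\<Prod>k=1..N0. (q2 \<tau> \<epsilon> * s \<tau> \<epsilon> i - s \<tau> \<epsilon> k) / (inverse (q2 \<tau> \<epsilon>) * s \<tau> \<epsilon> i - s \<tau> \<epsilon> k))
      * (\<Prod>k=1..N1. ((q1 \<tau> \<epsilon> * s \<tau> \<epsilon> i - t \<tau> \<epsilon> k) * (q3 \<tau> \<epsilon> * s \<tau> \<epsilon> i - t \<tau> \<epsilon> k)) /
          ((inverse (q1 \<tau> \<epsilon>) * s \<tau> \<epsilon> i - t \<tau> \<epsilon> k) * (inverse (q3 \<tau> \<epsilon>) * s \<tau> \<epsilon> i - t \<tau> \<epsilon> k))) = - 1"
    using bethe by (elim eventually_mono) (use i in \<open>simp add: bethe_solution_def P_def\<close>)
  have coeff: "((\<lambda>\<tau>. r - pihat + v / (s_ilw \<tau> i - v)) \<longlongrightarrow> r - pihat + v / (s_bar i - v)) G"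
    by (intro tendsto_intros si(1)) (use si(3) in simp)
  have "(r - pihat + v / (s_bar i - v) - 1) / s_bar i
      - (\<Sum>k\<in>{1..N0} - {i}. 2 / (s_bar i - s_bar k)) + (\<Sum>k=1..N1. 2 / (s_bar i - t_bar k)) = 0"
    by (rule bethe_conformal_limit[OF eps_to_0 tau_to_0 i P coeff regime ilw_limit_s ilw_limit_t
        conformal_limit_s conformal_limit_t si(2) nondeg_s(2) bspec[OF nondeg_st i] eq])
  \<comment> \<open>As \<open>v / (s - v) = s / (s - v) - 1\<close>, the factor with \<open>v\<close> contributes the second unit in
    \<open>r - pihat - 2\<close>; the first one comes from the diagonal factor.\<close>
  moreover have "(r - pihat + v / (s_bar i - v) - 1) / s_bar i
      = (r - pihat - 2) / s_bar i + 1 / (s_bar i - v)"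
    using si(2,3) by (simp add: divide_simps) (simp add: algebra_simps)
  ultimately show "(r - pihat - 2) / s_bar i + 1 / (s_bar i - v)
      - (\<Sum>k\<in>{1..N0} - {i}. 2 / (s_bar i - s_bar k)) + (\<Sum>k=1..N1. 2 / (s_bar i - t_bar k)) = 0"
    by simp
next
  fix j assume j: "j \<in> {1..N1}"
  have ts: "\<forall>k\<in>{1..N0}. t_bar j \<noteq> s_bar k"
    using nondeg_st j by metis
  have P: "\<forall>\<^sub>F \<tau> in G. expands F (p1 \<tau>) 1 pihat"
    using regime by eventually_elim (auto simp: ilw_regime_def intro: expands_smallo[OF eps_to_0(1)])
  have eq: "\<forall>\<^sub>F \<tau> in G. \<forall>\<^sub>F \<epsilon> in F. p1 \<tau> \<epsilon>
      * (\<Prod>k=1..N1. (q2 \<tau> \<epsilon> * t \<tau> \<epsilon> j - t \<tau> \<epsilon> k) / (inverse (q2 \<tau> \<epsilon>) * t \<tau> \<epsilon> j - t \<tau> \<epsilon> k))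
      * (\<Prod>k=1..N0. ((q1 \<tau> \<epsilon> * t \<tau> \<epsilon> j - s \<tau> \<epsilon> k) * (q3 \<tau> \<epsilon> * t \<tau> \<epsilon> j - s \<tau> \<epsilon> k)) /
          ((inverse (q1 \<tau> \<epsilon>) * t \<tau> \<epsilon> j - s \<tau> \<epsilon> k) * (inverse (q3 \<tau> \<epsilon>) * t \<tau> \<epsilon> j - s \<tau> \<epsilon> k))) = - 1"
    using bethe by (elim eventually_mono) (use j in \<open>simp add: bethe_solution_def\<close>)
  show "(pihat - 1) / t_bar j
      - (\<Sum>k\<in>{1..N1} - {j}. 2 / (t_bar j - t_bar k)) + (\<Sum>k=1..N0. 2 / (t_bar j - s_bar k)) = 0"
    by (rule bethe_conformal_limit[OF eps_to_0 tau_to_0 j P tendsto_const regime ilw_limit_t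
        ilw_limit_s conformal_limit_t conformal_limit_s bspec[OF nondeg_t(1) j] nondeg_t(2) ts eq])
qed

end
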